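(* Let $L$ be a Hilbert space and $G$ a (not necessarily abelian) group of unitary operators on $L$. Let $\mathcal{A}$ be the von Neumann algebra of bounded operators on $L$ commuting with $G$. Let $M$ be a (possibly unbounded) operator on $L$ with dense domain $D$. Suppose that: (1) $\mathcal{A}$ is abelian; (2) $(M,D)$ is symmetric; (3) $(M,D)$ commutes with the elements of $G$. Then $(M,D)$ has a unique self-adjoint extension, and this extension commutes with the operators in $\mathcal{A}$.
   Context: A (possibly unbounded) operator $M$ on $L$ with domain $D$ is said to commute with a bounded operator $A$ if for all $v\in L$: $v\in D$ implies $A(v)\in D$ and $M(A(v))=A(M(v))$. Hilbert spaces are complex and operators are linear. *)

theory Defs
  imports "HOL-Analysis.Analysis"
begin

text \<open>
  Complex inner product spaces, with the inner product linear in the first argument. The class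
  extends \<^class>\<open>real_inner\<close>: a complex inner product space carries the real inner product
  Re (cinner x y), and the norm and the topology are those of \<^class>\<open>real_inner\<close>. Positive
  definiteness of cinner is inherited; see \<open>cinner_self\<close> below.
\<close>

class complex_inner = real_inner +
  fixes scaleC :: "complex \<Rightarrow> 'a \<Rightarrow> 'a" (infixr \<open>*\<^sub>C\<close> 75)
    and cinner :: "'a \<Rightarrow> 'a \<Rightarrow> complex"
  assumes scaleC_of_real: "complex_of_real r *\<^sub>C x = r *\<^sub>R x"
    and scaleC_add_right: "c *\<^sub>C (x + y) = c *\<^sub>C x + c *\<^sub>C y"
    and scaleC_add_left: "(c + d) *\<^sub>C x = c *\<^sub>C x + d *\<^sub>C x"
    and scaleC_scaleC: "c *\<^sub>C d *\<^sub>C x = (c * d) *\<^sub>C x"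
    and cinner_add_left: "cinner (x + y) z = cinner x z + cinner y z"
    and cinner_scaleC_left: "cinner (c *\<^sub>C x) y = c * cinner x y"
    and cinner_commute: "cinner x y = cnj (cinner y x)"
    and Re_cinner: "Re (cinner x y) = inner x y"

class complex_hilbert_space = complex_inner + complete_space

global_interpretation cvs: vector_space "scaleC :: complex \<Rightarrow> 'a \<Rightarrow> 'a::complex_inner"
proof
  show "1 *\<^sub>C x = x" for x :: 'a
    using scaleC_of_real[of 1 x] by simp
qed (simp_all add: scaleC_add_right scaleC_add_left scaleC_scaleC)

lemma cinner_self: "cinner x x = complex_of_real ((norm x)\<^sup>2)"
proof (rule complex_eqI)
  show "Re (cinner x x) = Re (complex_of_real ((norm x)\<^sup>2))"
    by (simp add: Re_cinner power2_norm_eq_inner)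
  show "Im (cinner x x) = Im (complex_of_real ((norm x)\<^sup>2))"
    using arg_cong[OF cinner_commute[of x x], of Im] by simp
qed

instantiation complex :: complex_hilbert_space
begin

definition scaleC_complex :: "complex \<Rightarrow> complex \<Rightarrow> complex"
  where "scaleC_complex c x = c * x"

definition cinner_complex :: "complex \<Rightarrow> complex \<Rightarrow> complex"
  where "cinner_complex x y = x * cnj y"

instance
  by standard
    (simp_all add: scaleC_complex_def cinner_complex_def scaleR_conv_of_real
      inner_complex_def algebra_simps)

end

definition bounded_operator :: "('a::complex_inner \<Rightarrow> 'a) \<Rightarrow> bool" where
  "bounded_operator A \<longleftrightarrow> bounded_linear A \<and> (\<forall>c x. A (c *\<^sub>C x) = c *\<^sub>C A x)"

definition unitary_operator :: "('a::complex_inner \<Rightarrow> 'a) \<Rightarrow> bool" where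
  "unitary_operator U \<longleftrightarrow>
     bounded_operator U \<and> surj U \<and> (\<forall>x y. cinner (U x) (U y) = cinner x y)"

definition unitary_group :: "('a::complex_inner \<Rightarrow> 'a) set \<Rightarrow> bool" where
  "unitary_group G \<longleftrightarrow>
     (\<forall>U\<in>G. unitary_operator U) \<and> id \<in> G \<and>
     (\<forall>U\<in>G. \<forall>V\<in>G. U \<circ> V \<in> G) \<and> (\<forall>U\<in>G. inv U \<in> G)"

definition commutant :: "('a::complex_inner \<Rightarrow> 'a) set \<Rightarrow> ('a \<Rightarrow> 'a) set" where
  "commutant G = {A. bounded_operator A \<and> (\<forall>U\<in>G. A \<circ> U = U \<circ> A)}"

definition abelian_algebra :: "('a \<Rightarrow> 'a) set \<Rightarrow> bool" where
  "abelian_algebra \<A> \<longleftrightarrow> (\<forall>A\<in>\<A>. \<forall>B\<in>\<A>. A \<circ> B = B \<circ> A)"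

text \<open>
  A possibly unbounded operator with domain D is a partial function M with dom M = D; its value at
  v in D is the (M v). Then \<open>N extends M\<close> is \<open>M \<subseteq>\<^sub>m N\<close>, and equality of partial functions is
  equality of domains and of values on them.
\<close>

definition linear_operator :: "('a::complex_inner \<rightharpoonup> 'a) \<Rightarrow> bool" where
  "linear_operator M \<longleftrightarrow>
     cvs.subspace (dom M) \<and>
     (\<forall>v\<in>dom M. \<forall>w\<in>dom M. the (M (v + w)) = the (M v) + the (M w)) \<and>
     (\<forall>c. \<forall>v\<in>dom M. the (M (c *\<^sub>C v)) = c *\<^sub>C the (M v))"

definition densely_defined :: "('a::complex_inner \<rightharpoonup> 'a) \<Rightarrow> bool" where
  "densely_defined M \<longleftrightarrow> closure (dom M) = UNIV"

definition symmetric_operator :: "('a::complex_inner \<rightharpoonup> 'a) \<Rightarrow> bool" where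
  "symmetric_operator M \<longleftrightarrow>
     (\<forall>v\<in>dom M. \<forall>w\<in>dom M. cinner (the (M v)) w = cinner v (the (M w)))"

text \<open>
  The domain of the adjoint consists of the w for which some u satisfies
  cinner (M v) w = cinner v u for all v in dom M; the adjoint sends w to that u. The vector u is
  unique when M is densely defined, which is the only case in which the adjoint is used.
\<close>

definition adjoint_operator :: "('a::complex_inner \<rightharpoonup> 'a) \<Rightarrow> ('a \<rightharpoonup> 'a)" where
  "adjoint_operator M =
     (\<lambda>w. if \<exists>u. \<forall>v\<in>dom M. cinner (the (M v)) w = cinner v u
          then Some (THE u. \<forall>v\<in>dom M. cinner (the (M v)) w = cinner v u)
          else None)"

definition self_adjoint_operator :: "('a::complex_inner \<rightharpoonup> 'a) \<Rightarrow> bool" where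
  "self_adjoint_operator M \<longleftrightarrow>
     linear_operator M \<and> densely_defined M \<and> adjoint_operator M = M"

definition commutes_with :: "('a::complex_inner \<rightharpoonup> 'a) \<Rightarrow> ('a \<Rightarrow> 'a) \<Rightarrow> bool" where
  "commutes_with M A \<longleftrightarrow>
     (\<forall>v\<in>dom M. A v \<in> dom M \<and> the (M (A v)) = A (the (M v)))"

end

theory Submission
  imports Defs
begin

text \<open>
  Let \<open>\<Gamma>\<close> be the closure of the graph of M. For s = i and s = -i the space \<open>K\<^sub>s\<close> of all w + s v
  with (v, w) in \<open>\<Gamma>\<close> is closed, and the Cayley transform \<open>V\<^sub>s\<close>, which sends w + s v to w - s v and
  vanishes on the orthogonal complement of \<open>K\<^sub>s\<close>, is a partial isometry commuting with G. The
  product of \<open>V\<^sub>-\<^sub>s\<close> and \<open>V\<^sub>s\<close> is the projection onto \<open>K\<^sub>s\<close>. As the commutant is abelian, the two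
  projections coincide, so the two spaces \<open>K\<^sub>s\<close> are equal; they then contain the domain of M
  and are therefore the whole space, which makes the closure of M self-adjoint. An operator in the
  commutant commutes with the Cayley transform and hence preserves \<open>\<Gamma>\<close>.
\<close>

section \<open>Complex inner product spaces\<close>

lemma cinner_add_right: "cinner x (y + z) = cinner x y + cinner x z"
  by (metis cinner_add_left cinner_commute complex_cnj_add)

lemma cinner_scaleC_right: "cinner x (c *\<^sub>C y) = cnj c * cinner x y"
  by (metis cinner_commute cinner_scaleC_left complex_cnj_mult)

lemma cinner_diff_left: "cinner (x - y) z = cinner x z - cinner y z"
  by (metis add_diff_cancel cinner_add_left diff_add_cancel)

lemma cinner_diff_right: "cinner x (y - z) = cinner x y - cinner x z"
  by (metis add_diff_cancel cinner_add_right diff_add_cancel)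

lemma cinner_zero_left [simp]: "cinner 0 x = 0"
  using cinner_diff_left[of 0 0 x] by simp

lemma norm_scaleC: "norm (c *\<^sub>C x) = cmod c * norm (x::'a::complex_inner)"
proof -
  have "complex_of_real ((norm (c *\<^sub>C x))\<^sup>2) = (c * cnj c) * cinner x x"
    unfolding cinner_self[symmetric] by (simp add: cinner_scaleC_left cinner_scaleC_right)
  also have "\<dots> = complex_of_real ((cmod c * norm x)\<^sup>2)"
    by (simp add: cinner_self power_mult_distrib flip: complex_norm_square)
  finally have "complex_of_real ((norm (c *\<^sub>C x))\<^sup>2) = complex_of_real ((cmod c * norm x)\<^sup>2)" .
  hence "(norm (c *\<^sub>C x))\<^sup>2 = (cmod c * norm x)\<^sup>2"
    using of_real_eq_iff by blast
  thus ?thesis by simp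
qed

lemma scaleR_scaleC_commute: "r *\<^sub>R c *\<^sub>C x = c *\<^sub>C r *\<^sub>R (x::'a::complex_inner)"
  by (simp add: scaleC_scaleC mult.commute flip: scaleC_of_real)

lemma bounded_linear_scaleC: "bounded_linear (\<lambda>x::'a::complex_inner. c *\<^sub>C x)"
  by (rule bounded_linear_intro[where K = "cmod c"])
    (simp_all add: scaleC_add_right scaleR_scaleC_commute norm_scaleC mult.commute)

text \<open>Reduces to the real Cauchy-Schwarz inequality: multiplying \<open>x\<close> by a
  suitable unimodular \<open>c\<close> turns the complex product into its modulus.\<close>

lemma norm_cinner_le: "cmod (cinner x y) \<le> norm x * norm (y::'a::complex_inner)"
proof (cases "cinner x y = 0")
  case False
  define c where "c = cnj (sgn (cinner x y))"
  have "c * cinner x y = cmod (cinner x y)"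
    using False by (simp add: c_def sgn_div_norm scaleR_conv_of_real complex_norm_square[symmetric]
        divide_simps power2_eq_square mult.commute)
  hence "cmod (cinner x y) = inner (c *\<^sub>C x) y"
    by (metis Re_cinner Re_complex_of_real cinner_scaleC_left)
  also have "\<dots> \<le> norm (c *\<^sub>C x) * norm y"
    by (rule norm_cauchy_schwarz)
  finally show ?thesis
    using False by (simp add: norm_scaleC c_def norm_sgn)
qed simp

lemma bounded_bilinear_cinner: "bounded_bilinear (cinner :: 'a::complex_inner \<Rightarrow> _)"
proof
  fix r :: real and a b :: 'a
  show "cinner (r *\<^sub>R a) b = r *\<^sub>R cinner a b" "cinner a (r *\<^sub>R b) = r *\<^sub>R cinner a b"
    unfolding scaleC_of_real[symmetric]
    by (simp_all add: cinner_scaleC_left cinner_scaleC_right scaleC_complex_def)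
  show "\<exists>K. \<forall>a b::'a. cmod (cinner a b) \<le> norm a * norm b * K"
    by (rule exI[of _ 1]) (simp add: norm_cinner_le)
qed (simp_all add: cinner_add_left cinner_add_right)

lemmas continuous_on_cinner [continuous_intros] =
  bounded_bilinear.continuous_on[OF bounded_bilinear_cinner]

text \<open>The \<open>v\<close> with equal products form a closed set, hence everything; then take
  \<open>v = x - y\<close>. This makes adjoints, and operators given by a symmetric relation,
  single-valued.\<close>

lemma cinner_dense_cancel:
  assumes "closure D = (UNIV :: 'a::complex_inner set)" and "\<And>v. v \<in> D \<Longrightarrow> cinner v x = cinner v y"
  shows "x = y"
proof -
  have "D \<subseteq> {v. cinner v x = cinner v y}"
    using assms(2) by blast
  moreover have "closed {v. cinner v x = cinner v y}"
    by (intro closed_Collect_eq continuous_intros)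
  ultimately have "closure D \<subseteq> {v. cinner v x = cinner v y}"
    by (rule closure_minimal)
  hence "cinner (x - y) (x - y) = 0"
    using assms(1) by (auto simp: cinner_diff_right)
  thus ?thesis by (simp add: cinner_self)
qed

section \<open>Orthogonal projection onto a closed subspace\<close>

text \<open>The sets \<open>S n\<close> of almost minimizers are closed, nested and nonempty, and
  their diameters tend to 0. Completeness gives them a common point, which attains the infimum
  \<open>d\<close>.\<close>

lemma closed_subspace_nearest_point:
  fixes K :: "'a::{real_inner,complete_space} set"
  assumes "closed K" "subspace K"
  obtains p where "p \<in> K" "\<And>k. k \<in> K \<Longrightarrow> norm (x - p) \<le> norm (x - k)"
proof -
  define d where "d = (INF k\<in>K. (norm (x - k))\<^sup>2)"
  have K0: "0 \<in> K" using assms(2) by (rule subspace_0)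
  have bdd: "bdd_below ((\<lambda>k. (norm (x - k))\<^sup>2) ` K)"
    by (rule bdd_belowI[of _ 0]) auto
  have d_le: "d \<le> (norm (x - k))\<^sup>2" if "k \<in> K" for k
    unfolding d_def using bdd that by (rule cINF_lower)
  define S where "S n = {k \<in> K. (norm (x - k))\<^sup>2 \<le> d + 1 / real (Suc n)}" for n
  have dist_le: "(dist k l)\<^sup>2 \<le> 4 / real (Suc n)" if "k \<in> S n" "l \<in> S n" for k l n
  proof -
    have "(1/2) *\<^sub>R (k + l) \<in> K"
      using that assms(2) by (simp add: S_def subspace_add subspace_scale)
    hence "d \<le> (norm (x - (1/2) *\<^sub>R (k + l)))\<^sup>2" by (rule d_le)
    \<comment> \<open>Parallelogram law for \<open>x - k\<close> and \<open>x - l\<close>; the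
      midpoint of \<open>k\<close> and \<open>l\<close> lies in \<open>K\<close>, so its squared
      distance to \<open>x\<close> is at least \<open>d\<close>.\<close>
    moreover have "(dist k l)\<^sup>2 = 2 * (norm (x - k))\<^sup>2 + 2 * (norm (x - l))\<^sup>2
        - 4 * (norm (x - (1/2) *\<^sub>R (k + l)))\<^sup>2"
      unfolding dist_norm power2_norm_eq_inner
      by (simp add: inner_diff_left inner_diff_right inner_add_left inner_add_right
          inner_commute algebra_simps)
    ultimately show ?thesis
      using that by (simp add: S_def)
  qed
  obtain p where p: "\<And>n. p \<in> S n"
  proof (rule decreasing_closed_nest[of S])
    show "closed (S n)" for n
      unfolding S_def Collect_conj_eq
      using assms(1) by (intro closed_Int closed_Collect_le continuous_intros) simp_all
    show "S n \<noteq> {}" for n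
    proof -
      have "\<exists>k\<in>K. (norm (x - k))\<^sup>2 < d + 1 / real (Suc n)"
        unfolding d_def using K0 bdd
        by (subst cINF_less_iff[symmetric]) auto
      thus ?thesis unfolding S_def by force
    qed
    show "S n \<subseteq> S m" if "m \<le> n" for m n
    proof -
      have "1 / real (Suc n) \<le> 1 / real (Suc m)" using that by (simp add: frac_le)
      thus ?thesis unfolding S_def by auto
    qed
    show "\<exists>n. \<forall>k\<in>S n. \<forall>l\<in>S n. dist k l < e" if "e > 0" for e :: real
    proof -
      have "e\<^sup>2 / 4 > 0" using that by simp
      then obtain n where "inverse (real (Suc n)) < e\<^sup>2 / 4"
        using reals_Archimedean by blast
      hence n: "4 / real (Suc n) < e\<^sup>2" by (simp add: field_simps)
      have "dist k l < e" if kl: "k \<in> S n" "l \<in> S n" for k l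
        using dist_le[OF kl] n \<open>e > 0\<close> by (intro power_less_imp_less_base[of _ 2 e]) auto
      thus ?thesis by blast
    qed
  qed (rule that, blast)
  have near: "(norm (x - p))\<^sup>2 \<le> d"
  proof (rule field_le_epsilon)
    fix e :: real assume "e > 0"
    then obtain n where "inverse (real (Suc n)) < e"
      using reals_Archimedean by blast
    thus "(norm (x - p))\<^sup>2 \<le> d + e"
      using p[of n] by (simp add: S_def inverse_eq_divide)
  qed
  have le: "norm (x - p) \<le> norm (x - k)" if "k \<in> K" for k
    by (rule power2_le_imp_le[OF order_trans[OF near d_le[OF that]] norm_ge_zero])
  have "p \<in> K" using p[of 0] by (simp add: S_def)
  thus thesis using le by (rule that)
qed

lemma closed_subspace_orthogonal_projection:
  fixes K :: "'a::{real_inner,complete_space} set"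
  assumes "closed K" "subspace K"
  obtains p where "p \<in> K" "\<And>k. k \<in> K \<Longrightarrow> inner (x - p) k = 0"
proof -
  obtain p where p: "p \<in> K" "\<And>k. k \<in> K \<Longrightarrow> norm (x - p) \<le> norm (x - k)"
    using closed_subspace_nearest_point[OF assms] by metis
  have "inner (x - p) k = 0" if "k \<in> K" for k
  proof (cases "k = 0")
    case False
    \<comment> \<open>This \<open>t\<close> minimizes the quadratic function sending
      \<open>t\<close> to the squared norm of \<open>x - p - t k\<close>; a nonzero inner product
      would make the minimum smaller than at \<open>t = 0\<close>.\<close>
    define t where "t = inner (x - p) k / inner k k"
    have kk: "inner k k > 0" using False by simp
    have "p + t *\<^sub>R k \<in> K"
      using p(1) that assms(2) by (simp add: subspace_add subspace_scale)
    hence "(norm (x - p))\<^sup>2 \<le> (norm (x - p - t *\<^sub>R k))\<^sup>2"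
      using p(2) by (metis diff_diff_eq norm_ge_zero power_mono)
    also have "\<dots> = (norm (x - p))\<^sup>2 - (inner (x - p) k)\<^sup>2 / inner k k"
      using kk unfolding power2_norm_eq_inner inner_diff_left[of "x - p"] inner_diff_right[of _ "x - p"]
      by (simp add: t_def inner_commute power2_eq_square)
    finally show ?thesis
      using kk by (simp add: divide_le_0_iff)
  qed simp
  with p(1) show thesis by (rule that)
qed

section \<open>The Cayley transform of a closed symmetric relation\<close>

text \<open>A relation rather than an operator, since the closure of a graph is not known beforehand
  to be a graph; single-valuedness is derived in \<open>functional\<close>.\<close>

locale closed_symmetric_relation =
  fixes \<Gamma> :: "('a::complex_hilbert_space \<times> 'a) set"
  assumes closed_rel: "closed \<Gamma>"
    and zero_mem: "(0, 0) \<in> \<Gamma>"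
    and add_mem: "(v, w) \<in> \<Gamma> \<Longrightarrow> (v', w') \<in> \<Gamma> \<Longrightarrow> (v + v', w + w') \<in> \<Gamma>"
    and scaleC_mem: "(v, w) \<in> \<Gamma> \<Longrightarrow> (c *\<^sub>C v, c *\<^sub>C w) \<in> \<Gamma>"
    and symmetric: "(v, w) \<in> \<Gamma> \<Longrightarrow> (v', w') \<in> \<Gamma> \<Longrightarrow> cinner w v' = cinner v w'"
    and dense_domain: "closure (fst ` \<Gamma>) = UNIV"
begin

lemma diff_mem: "(v, w) \<in> \<Gamma> \<Longrightarrow> (v', w') \<in> \<Gamma> \<Longrightarrow> (v - v', w - w') \<in> \<Gamma>"
  using add_mem[of v w "(-1) *\<^sub>C v'" "(-1) *\<^sub>C w'"] scaleC_mem[of v' w' "-1"] by simp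

text \<open>By symmetry, products of \<open>w\<close> with domain vectors depend only on
  \<open>v\<close>. This is the closability of densely defined symmetric operators.\<close>

lemma functional:
  assumes "(v, w) \<in> \<Gamma>" "(v, w') \<in> \<Gamma>"
  shows "w = w'"
proof (rule cinner_dense_cancel[OF dense_domain])
  fix u assume "u \<in> fst ` \<Gamma>"
  then obtain u' where "(u, u') \<in> \<Gamma>" by auto
  thus "cinner u w = cinner u w'"
    using assms symmetric by metis
qed

section \<open>Ranges of the operator shifted by i and -i\<close>

definition shift_range :: "complex \<Rightarrow> 'a set" where
  "shift_range s = (\<lambda>(v, w). w + s *\<^sub>C v) ` \<Gamma>"

text \<open>Symmetry makes \<open>cinner w v\<close> real; a factor i or -i makes it purely
  imaginary, so its real part vanishes.\<close>

lemma inner_shift: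
  assumes "(v, w) \<in> \<Gamma>" "s \<in> {\<i>, -\<i>}"
  shows "inner w (s *\<^sub>C v) = 0"
proof -
  have "cinner w v = cnj (cinner w v)"
    using symmetric[OF assms(1) assms(1)] cinner_commute[of v w] by simp
  hence "Im (cinner w v) = 0" by (simp add: complex_eq_iff)
  thus ?thesis
    unfolding Re_cinner[symmetric] using assms(2) by (auto simp: cinner_scaleC_right)
qed

text \<open>Pythagoras for the real inner product. The map from \<open>(v, w)\<close> to
  \<open>w + s v\<close> is thus isometric on \<Gamma> for both signs, which yields its injectivity,
  the closedness of its range and the isometry of the Cayley transform.\<close>

lemma norm_shift:
  assumes "(v, w) \<in> \<Gamma>" "s \<in> {\<i>, -\<i>}"
  shows "norm (w + s *\<^sub>C v) = norm (v, w)"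
proof -
  have "(norm (w + s *\<^sub>C v))\<^sup>2 = (norm (v, w))\<^sup>2"
    using norm_add_Pythagorean[of w "s *\<^sub>C v"] inner_shift[OF assms] assms(2)
    by (auto simp: orthogonal_def norm_Pair norm_scaleC)
  thus ?thesis by simp
qed

lemma shift_inject:
  assumes "(v, w) \<in> \<Gamma>" "(v', w') \<in> \<Gamma>" "s \<in> {\<i>, -\<i>}"
    and "w + s *\<^sub>C v = w' + s *\<^sub>C v'"
  shows "v = v'" "w = w'"
proof -
  have "norm (v - v', w - w') = norm (w - w' + s *\<^sub>C (v - v'))"
    using norm_shift[OF diff_mem[OF assms(1,2)] assms(3)] by simp
  also have "w - w' + s *\<^sub>C (v - v') = 0"
    using assms(4) by (simp add: cvs.scale_right_diff_distrib algebra_simps)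
  finally show "v = v'" "w = w'" by (simp_all add: norm_Pair)
qed

lemma subspace_rel: "subspace \<Gamma>"
  unfolding subspace_def
  by (auto simp: zero_prod_def zero_mem add_mem scaleC_mem simp flip: scaleC_of_real)

text \<open>An isometric linear image of the complete space \<Gamma> is complete, hence
  closed.\<close>

lemma shift_range:
  assumes "s \<in> {\<i>, -\<i>}"
  shows "closed (shift_range s)" "subspace (shift_range s)"
proof -
  have bl: "bounded_linear (\<lambda>(v, w). w + s *\<^sub>C v :: 'a)"
    unfolding case_prod_beta
    by (intro bounded_linear_add bounded_linear_snd
        bounded_linear_compose[OF bounded_linear_scaleC] bounded_linear_fst)
  show "subspace (shift_range s)"
    unfolding shift_range_def
    using bl subspace_rel by (intro linear_subspace_image bounded_linear.linear)
  have "complete (shift_range s)"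
    unfolding shift_range_def
  proof (rule complete_isometric_image[OF zero_less_one subspace_rel bl])
    show "\<forall>p\<in>\<Gamma>. 1 * norm p \<le> norm (case p of (v, w) \<Rightarrow> w + s *\<^sub>C v)"
      using norm_shift[OF _ assms] by auto
    show "complete \<Gamma>" using closed_rel by (simp add: complete_eq_closed)
  qed
  thus "closed (shift_range s)" by (rule complete_imp_closed)
qed

section \<open>Projection onto the shifted ranges\<close>

text \<open>The projection of \<open>x\<close> is recorded through its preimage
  \<open>(v, w)\<close> in \<Gamma>, so that \<open>w - s v\<close> can be read off along with the
  projection \<open>w + s v\<close>.\<close>

definition projects :: "complex \<Rightarrow> 'a \<Rightarrow> 'a \<Rightarrow> 'a \<Rightarrow> bool" where
  "projects s x v w \<longleftrightarrow> (v, w) \<in> \<Gamma> \<and> (\<forall>k\<in>shift_range s. cinner (x - (w + s *\<^sub>C v)) k = 0)"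

lemma projects_exists:
  assumes "s \<in> {\<i>, -\<i>}"
  obtains v w where "projects s x v w"
proof -
  obtain p where p: "p \<in> shift_range s" "\<And>k. k \<in> shift_range s \<Longrightarrow> inner (x - p) k = 0"
    using closed_subspace_orthogonal_projection[OF shift_range[OF assms]] by metis
  obtain v w where vw: "(v, w) \<in> \<Gamma>" "p = w + s *\<^sub>C v"
    using p(1) by (auto simp: shift_range_def)
  have "cinner (x - p) k = 0" if k: "k \<in> shift_range s" for k
  proof -
    obtain v' w' where k': "(v', w') \<in> \<Gamma>" "k = w' + s *\<^sub>C v'"
      using k by (auto simp: shift_range_def)
    \<comment> \<open>The projection is orthogonal only for the real inner product. Since the range
      is closed under multiplication by i, testing with i \<open>k\<close> also kills the imaginary
      part.\<close>
    have "\<i> *\<^sub>C k = \<i> *\<^sub>C w' + s *\<^sub>C (\<i> *\<^sub>C v')"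
      by (simp add: k'(2) scaleC_add_right scaleC_scaleC mult.commute)
    hence "\<i> *\<^sub>C k \<in> shift_range s"
      using scaleC_mem[OF k'(1)] by (force simp: shift_range_def)
    hence "Re (cinner (x - p) (\<i> *\<^sub>C k)) = 0" by (simp add: Re_cinner p(2))
    moreover have "Re (cinner (x - p) k) = 0" using k by (simp add: Re_cinner p(2))
    ultimately show ?thesis
      by (simp add: cinner_scaleC_right complex_eq_iff)
  qed
  thus thesis using that vw by (auto simp: projects_def)
qed

lemma projects_unique:
  assumes "projects s x v w" "projects s x v' w'" "s \<in> {\<i>, -\<i>}"
  shows "v = v'" "w = w'"
proof -
  define k where "k = (w - w') + s *\<^sub>C (v - v')"
  have m: "(v, w) \<in> \<Gamma>" "(v', w') \<in> \<Gamma>" using assms by (auto simp: projects_def)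
  have k: "k \<in> shift_range s"
    unfolding k_def shift_range_def using diff_mem[OF m] by force
  have "k = (x - (w' + s *\<^sub>C v')) - (x - (w + s *\<^sub>C v))"
    by (simp add: k_def cvs.scale_right_diff_distrib)
  hence "cinner k k = 0"
    using assms k by (metis cinner_diff_left diff_zero projects_def)
  hence "k = 0" by (simp add: cinner_self)
  hence "w + s *\<^sub>C v = w' + s *\<^sub>C v'"
    by (simp add: k_def cvs.scale_right_diff_distrib algebra_simps)
  thus "v = v'" "w = w'" using shift_inject[OF m assms(3)] by blast+
qed

lemma projects_shift: "(v, w) \<in> \<Gamma> \<Longrightarrow> projects s (w + s *\<^sub>C v) v w"
  by (simp add: projects_def)

lemma projects_add:
  assumes "projects s x v w" "projects s y v' w'"
  shows "projects s (x + y) (v + v') (w + w')"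
proof -
  have "x + y - (w + w' + s *\<^sub>C (v + v')) = (x - (w + s *\<^sub>C v)) + (y - (w' + s *\<^sub>C v'))"
    by (simp add: scaleC_add_right)
  thus ?thesis using assms add_mem unfolding projects_def by (metis add_0 cinner_add_left)
qed

lemma projects_scaleC:
  assumes "projects s x v w"
  shows "projects s (c *\<^sub>C x) (c *\<^sub>C v) (c *\<^sub>C w)"
proof -
  have "c *\<^sub>C x - (c *\<^sub>C w + s *\<^sub>C c *\<^sub>C v) = c *\<^sub>C (x - (w + s *\<^sub>C v))"
    by (simp add: scaleC_add_right cvs.scale_right_diff_distrib scaleC_scaleC mult.commute)
  thus ?thesis using assms scaleC_mem by (simp add: projects_def cinner_scaleC_left)
qed

lemma projects_norm_le:
  assumes "projects s x v w" "s \<in> {\<i>, -\<i>}"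
  shows "norm (w + s *\<^sub>C v) \<le> norm x"
proof -
  define p where "p = w + s *\<^sub>C v"
  have "p \<in> shift_range s"
    using assms by (force simp: projects_def shift_range_def p_def)
  hence "inner (x - p) p = 0"
    using assms by (simp add: projects_def p_def flip: Re_cinner)
  hence "(norm p)\<^sup>2 = inner x p" by (simp add: inner_diff_left power2_norm_eq_inner)
  also have "\<dots> \<le> norm x * norm p" by (rule norm_cauchy_schwarz)
  finally show ?thesis
    by (cases "p = 0") (auto simp: power2_eq_square p_def)
qed

section \<open>The Cayley transform and its membership in the commutant\<close>

definition cayley :: "complex \<Rightarrow> 'a \<Rightarrow> 'a" where
  "cayley s x = (THE y. \<exists>v w. projects s x v w \<and> y = w - s *\<^sub>C v)"

lemma cayley_eq:
  assumes "projects s x v w" "s \<in> {\<i>, -\<i>}"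
  shows "cayley s x = w - s *\<^sub>C v"
  unfolding cayley_def
  by (rule the_equality) (use assms projects_unique[OF assms(1) _ assms(2)] in blast)+

text \<open>The vector \<open>w - s v\<close> lies in \<open>shift_range (- s)\<close> with the same
  pair \<open>(v, w)\<close>, so the second transform just flips the sign back. The composite is the
  projection onto \<open>shift_range s\<close>.\<close>

lemma cayley_cayley:
  assumes "projects s x v w" "s \<in> {\<i>, -\<i>}"
  shows "cayley (- s) (cayley s x) = w + s *\<^sub>C v"
proof -
  have "projects (- s) (w - s *\<^sub>C v) v w"
    using projects_shift[of v w "- s"] assms(1) by (simp add: projects_def)
  hence "cayley (- s) (w - s *\<^sub>C v) = w - (- s) *\<^sub>C v"
    using assms(2) by (intro cayley_eq) auto
  thus ?thesis using cayley_eq[OF assms] by simp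
qed

text \<open>Linearity comes from adding and scaling the projecting pairs. The bound is 1: a
  projection followed by an isometry.\<close>

lemma bounded_operator_cayley:
  assumes s: "s \<in> {\<i>, -\<i>}"
  shows "bounded_operator (cayley s)"
proof -
  have scale: "cayley s (c *\<^sub>C x) = c *\<^sub>C cayley s x" for c x
  proof -
    obtain v w where p: "projects s x v w" using projects_exists[OF s] .
    show ?thesis
      unfolding cayley_eq[OF p s] cayley_eq[OF projects_scaleC[OF p] s]
      by (simp add: cvs.scale_right_diff_distrib scaleC_scaleC mult.commute)
  qed
  have "bounded_linear (cayley s)"
  proof (rule bounded_linear_intro[where K = 1])
    fix x y
    obtain v w where p: "projects s x v w" using projects_exists[OF s] .
    obtain v' w' where q: "projects s y v' w'" using projects_exists[OF s] .
    show "cayley s (x + y) = cayley s x + cayley s y"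
      unfolding cayley_eq[OF p s] cayley_eq[OF q s] cayley_eq[OF projects_add[OF p q] s]
      by (simp add: scaleC_add_right)
    show "cayley s (r *\<^sub>R x) = r *\<^sub>R cayley s x" for r
      unfolding scaleC_of_real[symmetric] by (rule scale)
    have m: "(v, w) \<in> \<Gamma>" using p by (simp add: projects_def)
    have "norm (w - s *\<^sub>C v) = norm (w + s *\<^sub>C v)"
      using norm_shift[OF m, of s] norm_shift[OF m, of "- s"] s by auto
    thus "norm (cayley s x) \<le> norm x * 1"
      using projects_norm_le[OF p s] by (simp add: cayley_eq[OF p s])
  qed
  thus ?thesis using scale by (simp add: bounded_operator_def)
qed

text \<open>If \<open>(v, w)\<close> is the projecting pair of \<open>x\<close>, then
  \<open>(U v, U w)\<close> is that of \<open>U x\<close>, because \<open>U\<close> preserves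
  \<Gamma> and inner products.\<close>

lemma cayley_in_commutant:
  assumes G: "unitary_group G" and s: "s \<in> {\<i>, -\<i>}"
    and inv: "\<And>U v w. U \<in> G \<Longrightarrow> (v, w) \<in> \<Gamma> \<Longrightarrow> (U v, U w) \<in> \<Gamma>"
  shows "cayley s \<in> commutant G"
proof -
  have "cayley s (U x) = U (cayley s x)" if U: "U \<in> G" for U x
  proof -
    have bop: "bounded_operator U'" if "U' \<in> G" for U'
      using G that by (auto simp: unitary_group_def unitary_operator_def)
    have lin: "U' (a + b) = U' a + U' b" "U' (a - b) = U' a - U' b" "U' (c *\<^sub>C a) = c *\<^sub>C U' a"
      if "U' \<in> G" for U' a b c
      using bop[OF that] linear_add linear_diff bounded_linear.linear
      unfolding bounded_operator_def by blast+
    have invU: "inv U \<in> G" and unitary: "cinner (U a) (U b) = cinner a b" and surj: "surj U" for a b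
      using G U by (auto simp: unitary_group_def unitary_operator_def)
    obtain v w where p: "projects s x v w" using projects_exists[OF s] .
    have "projects s (U x) (U v) (U w)"
      unfolding projects_def
    proof (intro conjI ballI)
      show "(U v, U w) \<in> \<Gamma>" using p inv[OF U] by (simp add: projects_def)
      fix k assume "k \<in> shift_range s"
      then obtain v' w' where k: "(v', w') \<in> \<Gamma>" "k = w' + s *\<^sub>C v'"
        by (auto simp: shift_range_def)
      \<comment> \<open>Orthogonality to \<open>k\<close> is pulled back along \<open>U\<close>; the
        inverse also belongs to \<open>G\<close>, so it keeps \<open>k\<close> in the range.\<close>
      have "inv U k = inv U w' + s *\<^sub>C inv U v'"
        by (simp add: k(2) lin[OF invU])
      hence "inv U k \<in> shift_range s"
        using inv[OF invU k(1)] by (force simp: shift_range_def)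
      hence "cinner (x - (w + s *\<^sub>C v)) (inv U k) = 0"
        using p by (simp add: projects_def)
      thus "cinner (U x - (U w + s *\<^sub>C U v)) k = 0"
        using unitary[of "x - (w + s *\<^sub>C v)" "inv U k"] surj_f_inv_f[OF surj]
        by (simp add: lin[OF U])
    qed
    thus ?thesis
      using p s by (simp add: cayley_eq lin[OF U])
  qed
  thus ?thesis
    using bounded_operator_cayley[OF s] by (auto simp: commutant_def)
qed

section \<open>Consequences of commutation with the Cayley transforms\<close>

text \<open>Commuting transforms give equal projections, so both shifted ranges agree. The common
  range contains \<open>w + s v\<close> and \<open>w - s v\<close>, hence the dense domain, and it
  is closed.\<close>

lemma shift_range_UNIV:
  assumes comm: "cayley \<i> \<circ> cayley (- \<i>) = cayley (- \<i>) \<circ> cayley \<i>"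
    and s: "s \<in> {\<i>, -\<i>}"
  shows "shift_range s = UNIV"
proof -
  have cc: "cayley (- t) (cayley t x) = cayley t (cayley (- t) x)" if "t \<in> {\<i>, -\<i>}" for t x
    using comm that by (auto dest: fun_cong simp: fun_eq_iff)
  have "v \<in> shift_range s" if m: "(v, w) \<in> \<Gamma>" for v w
  proof -
    \<comment> \<open>The vector \<open>w - s v\<close> is fixed by the projection onto
      \<open>shift_range (- s)\<close>, hence by the one onto \<open>shift_range s\<close>.\<close>
    obtain v' w' where p: "projects s (w - s *\<^sub>C v) v' w'" using projects_exists[OF s] .
    have s': "- s \<in> {\<i>, -\<i>}" using s by auto
    have "w' + s *\<^sub>C v' = cayley (- s) (cayley s (w - s *\<^sub>C v))"
      using cayley_cayley[OF p s] by simp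
    also have "\<dots> = cayley (- (- s)) (cayley (- s) (w - s *\<^sub>C v))"
      using cc[OF s] by simp
    also have "\<dots> = w + (- s) *\<^sub>C v"
      using cayley_cayley[OF projects_shift[OF m, of "- s"] s'] by simp
    finally have "w - s *\<^sub>C v = w' + s *\<^sub>C v'" by simp
    moreover have "(v', w') \<in> \<Gamma>" using p by (simp add: projects_def)
    ultimately have "w - s *\<^sub>C v \<in> shift_range s" by (force simp: shift_range_def)
    moreover have "w + s *\<^sub>C v \<in> shift_range s" using m by (force simp: shift_range_def)
    \<comment> \<open>Half the difference is \<open>s v\<close>; multiplying by \<open>- s\<close>,
      the inverse of \<open>s\<close>, then gives \<open>v\<close> itself.\<close>
    ultimately have sv: "(1/2) *\<^sub>R ((w + s *\<^sub>C v) - (w - s *\<^sub>C v)) \<in> shift_range s"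
      by (metis shift_range(2)[OF s] subspace_scale subspace_diff)
    have "(w + s *\<^sub>C v) - (w - s *\<^sub>C v) = 2 *\<^sub>R (s *\<^sub>C v)"
      by (simp add: scaleR_2)
    with sv have "s *\<^sub>C v \<in> shift_range s" by simp
    then obtain a b where ab: "(a, b) \<in> \<Gamma>" "s *\<^sub>C v = b + s *\<^sub>C a"
      by (auto simp: shift_range_def)
    have "v = (- s) *\<^sub>C (s *\<^sub>C v)" using s by (auto simp: scaleC_scaleC)
    also have "\<dots> = (- s) *\<^sub>C b + s *\<^sub>C ((- s) *\<^sub>C a)"
      unfolding ab(2) by (simp add: scaleC_add_right scaleC_scaleC mult.commute)
    finally show ?thesis
      using scaleC_mem[OF ab(1), of "- s"] unfolding shift_range_def by force
  qed
  hence "closure (fst ` \<Gamma>) \<subseteq> shift_range s"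
    using shift_range(1)[OF s] by (intro closure_minimal) auto
  thus ?thesis using dense_domain by auto
qed

text \<open>Surjectivity for i gives \<open>(v', w')\<close> in \<Gamma> such that the difference
  \<open>(z, u - w')\<close> is an adjoint pair with \<open>u - w'\<close> equal to -i
  \<open>z\<close>. Then \<open>z\<close> is orthogonal to the range for -i, which is everything, so
  \<open>z = 0\<close>.\<close>

lemma maximal:
  assumes full: "\<And>s. s \<in> {\<i>, -\<i>} \<Longrightarrow> shift_range s = UNIV"
    and adj: "\<And>v w. (v, w) \<in> \<Gamma> \<Longrightarrow> cinner w y = cinner v u"
  shows "(y, u) \<in> \<Gamma>"
proof -
  have "u + \<i> *\<^sub>C y \<in> shift_range \<i>" using full by auto
  then obtain v' w' where m: "(v', w') \<in> \<Gamma>" and eq: "u + \<i> *\<^sub>C y = w' + \<i> *\<^sub>C v'"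
    by (auto simp: shift_range_def)
  define z where "z = y - v'"
  have uw: "u - w' = (- \<i>) *\<^sub>C z"
    using eq by (simp add: z_def cvs.scale_right_diff_distrib algebra_simps)
  have "z \<in> shift_range (- \<i>)" using full by auto
  then obtain v w where vw: "(v, w) \<in> \<Gamma>" "z = w - \<i> *\<^sub>C v"
    by (auto simp: shift_range_def)
  have "cinner w z = cinner v (u - w')"
    using adj[OF vw(1)] symmetric[OF vw(1) m] by (simp add: z_def cinner_diff_right)
  also have "\<dots> = \<i> * cinner v z" by (simp only: uw cinner_scaleC_right) simp
  finally have "cinner z z = 0"
    using vw(2) by (metis cinner_diff_left cinner_scaleC_left eq_iff_diff_eq_0)
  hence "z = 0" by (simp add: cinner_self)
  hence "y = v'" "u = w'" using uw by (simp_all add: z_def)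
  thus ?thesis using m by simp
qed

text \<open>Full range provides \<open>(v', w')\<close> in \<Gamma> with
  \<open>A w + s A v = w' + s v'\<close>. Applying the Cayley transform gives the same equation with
  minus signs, and the two determine \<open>A v\<close> and \<open>A w\<close>.\<close>

lemma commuting_preserves:
  assumes A: "bounded_operator A" and s: "s \<in> {\<i>, -\<i>}"
    and comm: "A \<circ> cayley s = cayley s \<circ> A" and full: "shift_range s = UNIV"
    and m: "(v, w) \<in> \<Gamma>"
  shows "(A v, A w) \<in> \<Gamma>"
proof -
  have lin: "A (a + b) = A a + A b" "A (a - b) = A a - A b" "A (c *\<^sub>C a) = c *\<^sub>C A a" for a b c
    using A linear_add linear_diff bounded_linear.linear unfolding bounded_operator_def by blast+
  have "A (w + s *\<^sub>C v) \<in> shift_range s" using full by simp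
  then obtain v' w' where m': "(v', w') \<in> \<Gamma>" and eq: "A w + s *\<^sub>C A v = w' + s *\<^sub>C v'"
    by (auto simp: shift_range_def lin)
  have "A (cayley s (w + s *\<^sub>C v)) = cayley s (w' + s *\<^sub>C v')"
    using comm eq by (metis comp_apply lin(1,3))
  hence eq': "A w - s *\<^sub>C A v = w' - s *\<^sub>C v'"
    using cayley_eq[OF projects_shift[OF m] s] cayley_eq[OF projects_shift[OF m'] s]
    by (simp add: lin)
  have "2 *\<^sub>R A w = 2 *\<^sub>R w'"
    using arg_cong2[OF eq eq', of "(+)"] by (simp add: scaleR_2)
  moreover from this have "s *\<^sub>C A v = s *\<^sub>C v'" using eq by simp
  ultimately show ?thesis using m' s by auto
qed

end

section \<open>Self-adjoint extensions\<close>

text \<open>Density makes the described vector unique. The graph form expresses the adjoint by a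
  condition that passes to closures.\<close>

lemma adjoint_operator_eq_Some_iff:
  assumes "densely_defined M"
  shows "adjoint_operator M y = Some u \<longleftrightarrow> (\<forall>(v, w)\<in>Map.graph M. cinner w y = cinner v u)"
proof -
  define P where "P u \<longleftrightarrow> (\<forall>v\<in>dom M. cinner (the (M v)) y = cinner v u)" for u
  have "u = u'" if "P u" "P u'" for u u'
    using cinner_dense_cancel[of "dom M" u u'] assms that by (simp add: densely_defined_def P_def)
  hence "(THE u'. P u') = u" if "P u" for u
    using that by blast
  hence "adjoint_operator M y = Some u \<longleftrightarrow> P u"
    unfolding adjoint_operator_def P_def[symmetric] by auto
  also have "\<dots> \<longleftrightarrow> (\<forall>(v, w)\<in>Map.graph M. cinner w y = cinner v u)"
    by (force simp: P_def Map.graph_def)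
  finally show ?thesis .
qed

lemma graph_adjoint_operator:
  assumes "densely_defined M"
  shows "Map.graph (adjoint_operator M) = {(y, u). \<forall>(v, w)\<in>Map.graph M. cinner w y = cinner v u}"
  using adjoint_operator_eq_Some_iff[OF assms] by (auto simp: Map.graph_def)

lemma map_le_iff_graph: "M \<subseteq>\<^sub>m N \<longleftrightarrow> Map.graph M \<subseteq> Map.graph N"
  unfolding map_le_def Map.graph_def dom_def by (force simp: subset_iff)

lemma graph_inject: "Map.graph M = Map.graph N \<Longrightarrow> M = N"
  by (simp add: map_le_antisym map_le_iff_graph)

lemma (in closed_symmetric_relation) graph_operator:
  obtains N where "Map.graph N = \<Gamma>"
proof
  let ?N = "\<lambda>v. if \<exists>w. (v, w) \<in> \<Gamma> then Some (THE w. (v, w) \<in> \<Gamma>) else None"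
  have "(THE w. (v, w) \<in> \<Gamma>) = w" if "(v, w) \<in> \<Gamma>" for v w
    using that functional by blast
  thus "Map.graph ?N = \<Gamma>"
    by (auto simp: Map.graph_def split: if_splits)
qed

text \<open>Addition, scaling and the inner product are continuous, so each algebraic property of
  the graph passes to its closure.\<close>

lemma closed_symmetric_relation_closure_graph:
  fixes M :: "'a::complex_hilbert_space \<rightharpoonup> 'a"
  assumes "linear_operator M" "densely_defined M" "symmetric_operator M"
  shows "closed_symmetric_relation (closure (Map.graph M))"
proof
  let ?g = "Map.graph M"
  have graph: "(v, w) \<in> ?g \<longleftrightarrow> v \<in> dom M \<and> w = the (M v)" for v w
    by (auto simp: Map.graph_def)
  have g_add: "(v + v', w + w') \<in> ?g" if "(v, w) \<in> ?g" "(v', w') \<in> ?g" for v w v' w'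
    using that assms(1) unfolding linear_operator_def graph by (simp add: cvs.subspace_add)
  have g_scale: "(c *\<^sub>C v, c *\<^sub>C w) \<in> ?g" if "(v, w) \<in> ?g" for c v w
    using that assms(1) unfolding linear_operator_def graph by (simp add: cvs.subspace_scale)
  have g_sym: "cinner w v' = cinner v w'" if "(v, w) \<in> ?g" "(v', w') \<in> ?g" for v w v' w'
    using that assms(3) unfolding symmetric_operator_def graph by simp
  have fst_g: "fst ` ?g = dom M"
    by (force simp: Map.graph_def)
  show "closed (closure ?g)" by simp
  have "?g \<noteq> {}"
    using fst_g assms(2) by (auto simp: densely_defined_def)
  then obtain v w where "(v, w) \<in> ?g" by auto
  hence "(0, 0) \<in> ?g" using g_scale[of v w 0] by simp
  thus "(0, 0) \<in> closure ?g" using closure_subset by blast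
  show "(v + v', w + w') \<in> closure ?g" if "(v, w) \<in> closure ?g" "(v', w') \<in> closure ?g" for v w v' w'
  proof -
    have "(\<lambda>(p, q). p + q) ` closure (?g \<times> ?g) \<subseteq> closure ?g"
      using g_add closure_subset[of ?g]
      by (intro image_closure_subset) (auto intro!: continuous_intros simp: case_prod_beta subset_iff)
    thus ?thesis using that by (force simp: closure_Times)
  qed
  show "(c *\<^sub>C v, c *\<^sub>C w) \<in> closure ?g" if "(v, w) \<in> closure ?g" for c v w
  proof -
    have "(\<lambda>(v, w). (c *\<^sub>C v, c *\<^sub>C w)) ` closure ?g \<subseteq> closure ?g"
      using g_scale closure_subset[of ?g]
      by (intro image_closure_subset)
        (auto intro!: continuous_intros bounded_linear.continuous_on[OF bounded_linear_scaleC]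
          simp: case_prod_beta subset_iff)
    thus ?thesis using that by force
  qed
  show "cinner w v' = cinner v w'" if "(v, w) \<in> closure ?g" "(v', w') \<in> closure ?g" for v w v' w'
  proof -
    let ?T = "{(p, q). cinner (snd p) (fst q) = cinner (fst p) (snd q)} :: (('a \<times> 'a) \<times> ('a \<times> 'a)) set"
    have "closed ?T"
      unfolding case_prod_beta by (intro closed_Collect_eq continuous_intros)
    moreover have "?g \<times> ?g \<subseteq> ?T" using g_sym by auto
    ultimately have "closure (?g \<times> ?g) \<subseteq> ?T" by (intro closure_minimal)
    thus ?thesis using that by (force simp: closure_Times)
  qed
  have "dom M \<subseteq> fst ` closure ?g"
    using closure_subset[of ?g] fst_g by blast
  hence "closure (dom M) \<subseteq> closure (fst ` closure ?g)" by (rule closure_mono)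
  thus "closure (fst ` closure ?g) = UNIV"
    using assms(2) by (auto simp: densely_defined_def)
qed

text \<open>The graph of the adjoint contains \<Gamma> by symmetry and lies in it by
  \<open>maximal\<close>.\<close>

lemma (in closed_symmetric_relation) self_adjoint_operator_of_graph:
  assumes N: "Map.graph N = \<Gamma>" and full: "\<And>s. s \<in> {\<i>, -\<i>} \<Longrightarrow> shift_range s = UNIV"
  shows "self_adjoint_operator N"
proof -
  have N': "N v = Some w \<longleftrightarrow> (v, w) \<in> \<Gamma>" for v w
    unfolding N[symmetric] by (simp add: Map.graph_def)
  have memD: "(v, the (N v)) \<in> \<Gamma>" if "v \<in> dom N" for v
    using that by (auto simp flip: N')
  have memI: "v \<in> dom N" "the (N v) = w" if "(v, w) \<in> \<Gamma>" for v w
    using that by (auto simp flip: N')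
  have "dom N = fst ` \<Gamma>"
    by (force simp: N' dom_def)
  hence dense: "densely_defined N"
    using dense_domain by (simp add: densely_defined_def)
  have "linear_operator N"
    unfolding linear_operator_def cvs.subspace_def
  proof (intro conjI ballI allI)
    show "0 \<in> dom N" using zero_mem N' by blast
    show "x + y \<in> dom N" "the (N (x + y)) = the (N x) + the (N y)"
      if "x \<in> dom N" "y \<in> dom N" for x y
      using memI[OF add_mem[OF memD memD]] that by blast+
    show "c *\<^sub>C x \<in> dom N" "the (N (c *\<^sub>C x)) = c *\<^sub>C the (N x)" if "x \<in> dom N" for c x
      using memI[OF scaleC_mem[OF memD]] that by blast+
  qed
  moreover have "adjoint_operator N = N"
  proof (rule graph_inject)
    have "(y, u) \<in> \<Gamma> \<longleftrightarrow> (\<forall>(v, w)\<in>\<Gamma>. cinner w y = cinner v u)" for y u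
    proof
      show "(y, u) \<in> \<Gamma>" if "\<forall>(v, w)\<in>\<Gamma>. cinner w y = cinner v u"
        using full by (rule maximal) (use that in auto)
    qed (auto intro: symmetric)
    thus "Map.graph (adjoint_operator N) = Map.graph N"
      unfolding graph_adjoint_operator[OF dense] N
      by (intro set_eqI) (simp only: split_paired_all mem_Collect_eq case_prod_conv)
  qed
  ultimately show ?thesis using dense by (simp add: self_adjoint_operator_def)
qed

text \<open>A pair in the graph of \<open>N\<close> is adjoint to \<open>M\<close>, by continuity to
  \<Gamma>, hence in \<Gamma> by \<open>maximal\<close>. Conversely, a pair in \<Gamma> is adjoint
  to all of \<Gamma>, so to \<open>N\<close>, and self-adjointness puts it in the graph of
  \<open>N\<close>.\<close>

lemma (in closed_symmetric_relation) graph_self_adjoint_extension: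
  assumes full: "\<And>s. s \<in> {\<i>, -\<i>} \<Longrightarrow> shift_range s = UNIV"
    and N: "self_adjoint_operator N" and ext: "\<Gamma> = closure (Map.graph M)" "M \<subseteq>\<^sub>m N"
  shows "Map.graph N = \<Gamma>"
proof -
  have gN: "Map.graph N = {(y, u). \<forall>(v, w)\<in>Map.graph N. cinner w y = cinner v u}"
    using N graph_adjoint_operator[of N] by (simp add: self_adjoint_operator_def)
  have MN: "Map.graph M \<subseteq> Map.graph N" using ext(2) by (simp add: map_le_iff_graph)
  have sub: "Map.graph N \<subseteq> \<Gamma>"
  proof
    fix p assume p: "p \<in> Map.graph N"
    obtain y u where yu: "p = (y, u)" by (cases p)
    let ?T = "{(v, w). cinner w y = cinner v u}"
    have "Map.graph M \<subseteq> ?T" using p yu gN MN by blast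
    moreover have "closed ?T"
      unfolding case_prod_beta by (intro closed_Collect_eq continuous_intros)
    ultimately have "\<Gamma> \<subseteq> ?T" unfolding ext(1) by (rule closure_minimal)
    thus "p \<in> \<Gamma>" unfolding yu by (intro maximal[OF full]) auto
  qed
  moreover have "\<Gamma> \<subseteq> Map.graph N"
  proof
    fix p assume "p \<in> \<Gamma>"
    thus "p \<in> Map.graph N"
      using sub symmetric by (subst gN) (cases p, fastforce)
  qed
  ultimately show ?thesis by blast
qed

lemma closure_graph_invariant:
  assumes "bounded_linear U" "commutes_with M U" "(v, w) \<in> closure (Map.graph M)"
  shows "(U v, U w) \<in> closure (Map.graph M)"
proof -
  have "(U v, U w) \<in> Map.graph M" if "(v, w) \<in> Map.graph M" for v w
    using that assms(2) unfolding commutes_with_def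
    by (auto simp: Map.graph_def) (metis domD domI option.sel)
  hence "(\<lambda>(v, w). (U v, U w)) ` closure (Map.graph M) \<subseteq> closure (Map.graph M)"
    using closure_subset[of "Map.graph M"]
    by (intro image_closure_subset)
      (auto intro!: continuous_intros bounded_linear.continuous_on[OF assms(1)]
        simp: case_prod_beta subset_iff)
  thus ?thesis using assms(3) by force
qed

theorem theorem2p2:
  fixes G :: "('a::complex_hilbert_space \<Rightarrow> 'a) set"
    and M :: "'a \<rightharpoonup> 'a"
  assumes "unitary_group G"
    and "linear_operator M"
    and "densely_defined M"
    and "abelian_algebra (commutant G)"
    and "symmetric_operator M"
    and "\<forall>U\<in>G. commutes_with M U"
  shows "(\<exists>!N. self_adjoint_operator N \<and> M \<subseteq>\<^sub>m N) \<and>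
         (\<forall>N. self_adjoint_operator N \<and> M \<subseteq>\<^sub>m N \<longrightarrow> (\<forall>A\<in>commutant G. commutes_with N A))"
proof -
  define \<Gamma> where "\<Gamma> = closure (Map.graph M)"
  interpret closed_symmetric_relation \<Gamma>
    unfolding \<Gamma>_def using assms(2,3,5) by (rule closed_symmetric_relation_closure_graph)
  have bl: "bounded_linear U" if "U \<in> G" for U
    using assms(1) that by (simp add: unitary_group_def unitary_operator_def bounded_operator_def)
  have V: "cayley s \<in> commutant G" if "s \<in> {\<i>, -\<i>}" for s
    using assms(1) that
  proof (rule cayley_in_commutant)
    show "(U v, U w) \<in> \<Gamma>" if "U \<in> G" "(v, w) \<in> \<Gamma>" for U v w
      using closure_graph_invariant[OF bl[OF that(1)]] that assms(6) by (simp add: \<Gamma>_def)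
  qed
  have abel: "A \<circ> B = B \<circ> A" if "A \<in> commutant G" "B \<in> commutant G" for A B
    using assms(4) that by (simp add: abelian_algebra_def)
  \<comment> \<open>Both Cayley transforms lie in the abelian commutant, so they commute with each
    other.\<close>
  have full: "shift_range s = UNIV" if "s \<in> {\<i>, -\<i>}" for s
    using abel[OF V V] that by (intro shift_range_UNIV) auto
  obtain N0 where N0: "Map.graph N0 = \<Gamma>" by (rule graph_operator)
  have graph_ext: "Map.graph N = \<Gamma>" if "self_adjoint_operator N" "M \<subseteq>\<^sub>m N" for N
    using graph_self_adjoint_extension[OF full that(1) \<Gamma>_def that(2)] .
  have "\<exists>!N. self_adjoint_operator N \<and> M \<subseteq>\<^sub>m N"
  proof (rule ex1I)
    show "self_adjoint_operator N0 \<and> M \<subseteq>\<^sub>m N0"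
      using self_adjoint_operator_of_graph[OF N0 full] closure_subset
      by (simp add: map_le_iff_graph N0 \<Gamma>_def)
    show "N = N0" if "self_adjoint_operator N \<and> M \<subseteq>\<^sub>m N" for N
      using that graph_ext N0 by (intro graph_inject) simp
  qed
  moreover have "commutes_with N A"
    if "self_adjoint_operator N" "M \<subseteq>\<^sub>m N" and A: "A \<in> commutant G" for N A
  proof -
    have N: "N v = Some w \<longleftrightarrow> (v, w) \<in> \<Gamma>" for v w
      unfolding graph_ext[OF that(1,2), symmetric] by (simp add: Map.graph_def)
    \<comment> \<open>The commutant contains \<open>cayley \<i>\<close> and is abelian, so
      \<open>A\<close> commutes with this transform.\<close>
    have "(A v, A w) \<in> \<Gamma>" if "(v, w) \<in> \<Gamma>" for v w
      using A abel[OF A V[of \<i>]] full that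
      by (intro commuting_preserves[of A \<i>]) (auto simp: commutant_def)
    thus ?thesis
      unfolding commutes_with_def by (metis N domD domI option.sel)
  qed
  ultimately show ?thesis by blast
qed

end
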